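(* Let $m,n\geq 1$ and $k\geq 1$ be integers, and let $\phi\colon\mathbb{P}^{mn+m+n}\dashrightarrow\mathbb{P}^{mn+m+n}$ be the Cremona transformation given on $\{x_{00}\neq 0\}$, with $x_{00}=1$, by $$y_{i0}=x_{i0},\qquad y_{0j}=x_{0j},\qquad y_{ij}=x_{ij}-x_{i0}x_{0j}\qquad(1\leq i\leq m,\ 1\leq j\leq n).$$ Then $\phi$ maps the $k$-secant variety $\mathrm{Sec}_k(\mathrm{Seg}(m,n))$ to the cone over the $(k-1)$-secant variety $\mathrm{Sec}_{k-1}(\mathrm{Seg}(m-1,n-1))$ of $\mathrm{Seg}(m-1,n-1)$, where $\mathrm{Seg}(m-1,n-1)$ lies in the projective space with homogeneous coordinates $[y_{ij}]_{1\leq i\leq m,\,1\leq j\leq n}$, and the vertex of the cone is the linear image $\{y_{ij}=0 : 1\leq i\leq m,\ 1\leq j\leq n\}$ of $\mathrm{Seg}(m,n)$ under $\phi$.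
   Context: Everything is over $\mathbb{C}$. $\mathbb{P}^{mn+m+n}$ is the space of nonzero $(m+1)\times(n+1)$ matrices $(x_{ij})_{0\leq i\leq m,\,0\leq j\leq n}$ modulo nonzero scalars, and $[y_{ij}]_{0\leq i\leq m,\,0\leq j\leq n}$ are the homogeneous coordinates on the target. $\mathrm{Seg}(m,n)\subset\mathbb{P}^{mn+m+n}$ is the Segre variety, i.e. the locus of matrices of rank $1$ (a factor $\mathbb{P}^0$ is allowed in $\mathrm{Seg}(m-1,n-1)$). In homogeneous coordinates $\phi$ reads $y_{00}=x_{00}^2$, $y_{i0}=x_{00}x_{i0}$, $y_{0j}=x_{00}x_{0j}$, $y_{ij}=x_{00}x_{ij}-x_{i0}x_{0j}$. For $X\subset\mathbb{P}^N$ and $k\ge 0$, the $k$-secant variety $\mathrm{Sec}_k(X)$ is the Zariski closure of the union of all linear spaces of dimension $k$ that contain $k+1$ linearly independent points of $X$ (so $\mathrm{Sec}_0(X)=X$); for nondegenerate $X$ and $k\geq N$ it is understood to be $\mathbb{P}^N$. The image of a variety under $\phi$ is the Zariski closure of the image of its intersection with $\{x_{00}\neq0\}$. The cone over a subvariety $W$ of the projective space with coordinates $[y_{ij}]_{i,j\geq1}$ with vertex $L=\{y_{ij}=0: i,j\geq 1\}$ is the set of points $[y_{ij}]$ of $\mathbb{P}^{mn+m+n}$ that either lie in $L$ or satisfy $[y_{ij}]_{i,j\geq 1}\in W$. *)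

theory Defs
  imports "HOL-Analysis.Analysis" "HOL-Library.Poly_Mapping"
begin

section \<open>Complex projective space\<close>

text \<open>Coordinates are indexed by an arbitrary finite type, so \<open>'i proj\<close> is the projective
  space of dimension \<open>CARD('i) - 1\<close>.\<close>

definition proj_rel :: "complex ^ 'i::finite \<Rightarrow> complex ^ 'i \<Rightarrow> bool"
  where "proj_rel x y \<longleftrightarrow> x \<noteq> 0 \<and> y \<noteq> 0 \<and> (\<exists>c. c \<noteq> 0 \<and> y = c *s x)"

lemma part_equivp_proj_rel: "part_equivp (proj_rel :: complex ^ 'i::finite \<Rightarrow> _)"
proof (rule part_equivpI)
  show "\<exists>x :: complex ^ 'i. proj_rel x x"
    by (rule exI[of _ 1]) (auto simp: proj_rel_def intro!: exI[of _ 1])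
  show "symp (proj_rel :: complex ^ 'i \<Rightarrow> _)"
  proof (rule sympI)
    fix x y :: "complex ^ 'i"
    assume "proj_rel x y"
    then obtain c where "x \<noteq> 0" "y \<noteq> 0" "c \<noteq> 0" "y = c *s x"
      by (auto simp: proj_rel_def)
    moreover from this have "x = inverse c *s y"
      by (simp add: vec.scale_scale)
    ultimately show "proj_rel y x"
      unfolding proj_rel_def by (metis inverse_nonzero_iff_nonzero)
  qed
  show "transp (proj_rel :: complex ^ 'i \<Rightarrow> _)"
    by (rule transpI) (auto simp: proj_rel_def vec.scale_scale intro: no_zero_divisors)
qed

text \<open>\<open>point x\<close> is the point with homogeneous coordinates \<open>x\<close>; it is meaningful only
  for \<open>x \<noteq> 0\<close>.\<close>

quotient_type 'i proj = "complex ^ 'i::finite" / partial: proj_rel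
  morphisms proj_rep point
  by (rule part_equivp_proj_rel)

definition coords :: "'i::finite proj \<Rightarrow> (complex ^ 'i) set"
  where "coords P = {x. x \<noteq> 0 \<and> point x = P}"

lemma point_eq_iff:
  assumes "x \<noteq> 0" "y \<noteq> 0"
  shows "point x = point y \<longleftrightarrow> (\<exists>c. c \<noteq> 0 \<and> y = c *s x)"
proof -
  have "proj_rel x x" "proj_rel y y"
    using assms by (auto simp: proj_rel_def intro!: exI[of _ 1])
  then show ?thesis
    using Quotient_rel[OF Quotient_proj, of x y] assms by (auto simp: proj_rel_def)
qed

lemma coords_point:
  assumes "x \<noteq> 0"
  shows "coords (point x) = {c *s x | c. c \<noteq> 0}"
proof -
  have "y \<in> coords (point x) \<longleftrightarrow> (\<exists>c. c \<noteq> 0 \<and> y = c *s x)" for y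
  proof (cases "y = 0")
    case True
    then show ?thesis using assms by (auto simp: coords_def)
  next
    case False
    then show ?thesis
      using point_eq_iff[OF assms False] by (auto simp: coords_def)
  qed
  then show ?thesis by auto
qed

lemma proj_rep_coords: "proj_rep P \<in> coords P"
  using Quotient_rep_reflp[OF Quotient_proj, of P] Quotient_abs_rep[OF Quotient_proj, of P]
  by (auto simp: coords_def proj_rel_def)


section \<open>The Zariski topology\<close>

text \<open>Polynomials in the coordinates are finitely supported maps from exponent vectors to
  coefficients.\<close>

type_synonym 'i mpoly = "('i \<Rightarrow>\<^sub>0 nat) \<Rightarrow>\<^sub>0 complex"

definition mpoly_eval :: "'i::finite mpoly \<Rightarrow> complex ^ 'i \<Rightarrow> complex"
  where "mpoly_eval f x =
    (\<Sum>e\<in>Poly_Mapping.keys f. Poly_Mapping.lookup f e * (\<Prod>i\<in>UNIV. x $ i ^ Poly_Mapping.lookup e i))"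

definition homogeneous :: "nat \<Rightarrow> 'i::finite mpoly \<Rightarrow> bool"
  where "homogeneous d f \<longleftrightarrow>
    (\<forall>e\<in>Poly_Mapping.keys f. (\<Sum>i\<in>UNIV. Poly_Mapping.lookup e i) = d)"

definition zariski_closed :: "'i::finite proj set \<Rightarrow> bool"
  where "zariski_closed Z \<longleftrightarrow>
    (\<exists>F. (\<forall>f\<in>F. \<exists>d. homogeneous d f) \<and>
         Z = {P. \<forall>f\<in>F. \<forall>x\<in>coords P. mpoly_eval f x = 0})"

definition zariski_closure :: "'i::finite proj set \<Rightarrow> 'i proj set"
  where "zariski_closure S = zariski_closed hull S"


section \<open>Linear spaces and secant varieties\<close>

definition proj_subspace :: "(complex ^ 'i::finite) set \<Rightarrow> 'i proj set"
  where "proj_subspace V = {P. coords P \<subseteq> V}"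

definition linear_space :: "nat \<Rightarrow> 'i::finite proj set \<Rightarrow> bool"
  where "linear_space k \<Lambda> \<longleftrightarrow>
    (\<exists>V. vec.subspace V \<and> vec.dim V = k + 1 \<and> \<Lambda> = proj_subspace V)"

text \<open>Rescaling the chosen representatives does not affect linear independence.\<close>

definition proj_independent :: "'i::finite proj set \<Rightarrow> bool"
  where "proj_independent S \<longleftrightarrow> vec.independent (proj_rep ` S)"

definition nondegenerate :: "'i::finite proj set \<Rightarrow> bool"
  where "nondegenerate X \<longleftrightarrow> (\<forall>V. vec.subspace V \<and> X \<subseteq> proj_subspace V \<longrightarrow> V = UNIV)"

text \<open>The first branch is the convention for \<open>k\<close> at least the dimension
  of the ambient space.\<close>

definition secant_variety :: "nat \<Rightarrow> 'i::finite proj set \<Rightarrow> 'i proj set"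
  where "secant_variety k X =
    (if nondegenerate X \<and> k \<ge> CARD('i) - 1 then UNIV
     else zariski_closure (\<Union>{\<Lambda>. linear_space k \<Lambda> \<and>
       (\<exists>S. S \<subseteq> X \<and> S \<subseteq> \<Lambda> \<and> finite S \<and> card S = k + 1 \<and> proj_independent S)}))"


section \<open>Segre varieties, the Cremona transformation and cones\<close>

definition coord_matrix :: "complex ^ ('a::finite \<times> 'b::finite) \<Rightarrow> complex ^ 'b ^ 'a"
  where "coord_matrix x = (\<chi> i j. x $ (i, j))"

definition segre :: "('a::finite \<times> 'b::finite) proj set"
  where "segre = {P. \<forall>x\<in>coords P. rank (coord_matrix x) = 1}"

text \<open>With \<open>m = CARD('m)\<close> and \<open>n = CARD('n)\<close>, the row indices \<open>0, \<dots>, m\<close> are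
  modelled by \<open>'m option\<close> and the column indices \<open>0, \<dots>, n\<close> by \<open>'n option\<close>,
  where \<open>None\<close> is the index \<open>0\<close> and \<open>Some i\<close> are the indices \<open>i \<ge> 1\<close>.\<close>

definition cremona_coords ::
    "complex ^ ('m::finite option \<times> 'n::finite option) \<Rightarrow> complex ^ ('m option \<times> 'n option)"
  where "cremona_coords x = (\<chi> p. case p of
      (None, None) \<Rightarrow> (x $ (None, None))\<^sup>2
    | (Some i, None) \<Rightarrow> x $ (None, None) * x $ (Some i, None)
    | (None, Some j) \<Rightarrow> x $ (None, None) * x $ (None, Some j)
    | (Some i, Some j) \<Rightarrow>
        x $ (None, None) * x $ (Some i, Some j) - x $ (Some i, None) * x $ (None, Some j))"

definition affine_chart :: "('m::finite option \<times> 'n::finite option) proj set"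
  where "affine_chart = {P. \<forall>x\<in>coords P. x $ (None, None) \<noteq> 0}"

text \<open>The value of \<open>cremona\<close> is meaningful, and used, only on \<open>affine_chart\<close>.\<close>

definition cremona ::
    "('m::finite option \<times> 'n::finite option) proj \<Rightarrow> ('m option \<times> 'n option) proj"
  where "cremona P = point (cremona_coords (proj_rep P))"

lemma cremona_point:
  assumes "x $ (None, None) \<noteq> 0"
  shows "cremona (point x) = point (cremona_coords x)"
proof -
  have "x \<noteq> 0" using assms by auto
  then obtain c where c: "c \<noteq> 0" "proj_rep (point x) = c *s x"
    using proj_rep_coords[of "point x"] by (auto simp: coords_point)
  have eq: "cremona_coords (c *s x) = c\<^sup>2 *s cremona_coords x"
    by (auto simp: cremona_coords_def vec_eq_iff power2_eq_square algebra_simps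
        split: prod.splits option.splits)
  have "cremona_coords x $ (None, None) \<noteq> 0"
    using assms by (simp add: cremona_coords_def)
  then have nz: "cremona_coords x \<noteq> 0" by auto
  with c have nz': "c\<^sup>2 *s cremona_coords x \<noteq> 0" by simp
  have "point (cremona_coords x) = point (c\<^sup>2 *s cremona_coords x)"
    using point_eq_iff[OF nz nz'] c by auto
  then show ?thesis by (simp add: cremona_def c eq)
qed

lemma cremona_chart:
  assumes "x $ (None, None) = 1"
  obtains y where "cremona (point x) = point y" "y $ (None, None) = 1"
    "\<And>i. y $ (Some i, None) = x $ (Some i, None)"
    "\<And>j. y $ (None, Some j) = x $ (None, Some j)"
    "\<And>i j. y $ (Some i, Some j) = x $ (Some i, Some j) - x $ (Some i, None) * x $ (None, Some j)"
  by (rule that[of "cremona_coords x"]) (use assms in \<open>auto simp: cremona_point cremona_coords_def\<close>)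

definition cremona_image ::
    "('m::finite option \<times> 'n::finite option) proj set \<Rightarrow> ('m option \<times> 'n option) proj set"
  where "cremona_image X = zariski_closure (cremona ` (X \<inter> affine_chart))"

definition inner_block ::
    "complex ^ ('m::finite option \<times> 'n::finite option) \<Rightarrow> complex ^ ('m \<times> 'n)"
  where "inner_block y = (\<chi> p. y $ (Some (fst p), Some (snd p)))"

definition vertex_space :: "('m::finite option \<times> 'n::finite option) proj set"
  where "vertex_space = {P. \<forall>y\<in>coords P. inner_block y = 0}"

definition cone_over :: "('m::finite \<times> 'n::finite) proj set \<Rightarrow> ('m option \<times> 'n option) proj set"
  where "cone_over W =
    {P. P \<in> vertex_space \<or> (\<forall>y\<in>coords P. inner_block y \<noteq> 0 \<and> point (inner_block y) \<in> W)}"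

end

theory Submission
  imports Defs
begin

text \<open>A matrix with nonzero pivot \<open>x\<^sub>p\<^sub>q\<close> has rank at most \<open>k + 1\<close> iff its Schur complement
  \<open>x\<^sub>p\<^sub>q x\<^sub>i\<^sub>j - x\<^sub>i\<^sub>q x\<^sub>p\<^sub>j\<close> has rank at most \<open>k\<close>. For the pivot \<open>x\<^sub>0\<^sub>0\<close> the Schur complement is the inner block
  of the Cremona transformation, which is a bijection of the chart \<open>x\<^sub>0\<^sub>0 \<noteq> 0\<close> onto itself; so it
  matches matrices of rank at most \<open>k + 1\<close> with matrices whose inner block has rank at most \<open>k\<close>.
  Using all pivots at once, the same fact shows by induction on \<open>k\<close>, without minors, that rank at
  most \<open>k\<close> is a Zariski closed condition. Finally, the \<open>k\<close>-th secant variety of a Segre variety is the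
  locus of rank at most \<open>k + 1\<close>, for every \<open>k\<close>.\<close>

section \<open>Homogeneous polynomial functions\<close>

definition monomial_fun :: "('i::finite \<Rightarrow>\<^sub>0 nat) \<Rightarrow> complex ^ 'i \<Rightarrow> complex"
  where "monomial_fun e x = (\<Prod>i\<in>UNIV. x $ i ^ Poly_Mapping.lookup e i)"

definition monomial_degree :: "('i::finite \<Rightarrow>\<^sub>0 nat) \<Rightarrow> nat"
  where "monomial_degree e = (\<Sum>i\<in>UNIV. Poly_Mapping.lookup e i)"

text \<open>Homogeneity is moved from polynomials to the functions they define, so that equations
  can be built by pointwise algebra. The zero function counts in every degree.\<close>

definition hom_fun :: "nat \<Rightarrow> (complex ^ 'i::finite \<Rightarrow> complex) \<Rightarrow> bool"
  where "hom_fun d g \<longleftrightarrow> (\<exists>f. homogeneous d f \<and> mpoly_eval f = g)"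

lemma monomial_fun_add: "monomial_fun (e + e') x = monomial_fun e x * monomial_fun e' x"
  by (simp add: monomial_fun_def lookup_add power_add prod.distrib)

lemma monomial_degree_add: "monomial_degree (e + e') = monomial_degree e + monomial_degree e'"
  by (simp add: monomial_degree_def lookup_add sum.distrib)

lemma mpoly_eval_alt:
  "mpoly_eval f x = (\<Sum>e\<in>Poly_Mapping.keys f. Poly_Mapping.lookup f e * monomial_fun e x)"
  by (simp add: mpoly_eval_def monomial_fun_def)

lemma homogeneous_alt: "homogeneous d f \<longleftrightarrow> (\<forall>e\<in>Poly_Mapping.keys f. monomial_degree e = d)"
  by (simp add: homogeneous_def monomial_degree_def)

lemma mpoly_eval_superset:
  assumes "finite K" "Poly_Mapping.keys f \<subseteq> K"
  shows "mpoly_eval f x = (\<Sum>e\<in>K. Poly_Mapping.lookup f e * monomial_fun e x)"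
  unfolding mpoly_eval_alt
  by (rule sum.mono_neutral_left) (use assms in \<open>auto simp: in_keys_iff\<close>)

lemma mpoly_eval_add: "mpoly_eval (f + g) x = mpoly_eval f x + mpoly_eval g x"
proof -
  let ?K = "Poly_Mapping.keys f \<union> Poly_Mapping.keys g"
  have "mpoly_eval h x = (\<Sum>e\<in>?K. Poly_Mapping.lookup h e * monomial_fun e x)"
    if "Poly_Mapping.keys h \<subseteq> ?K" for h
    using that by (intro mpoly_eval_superset) auto
  then show ?thesis
    using Poly_Mapping.keys_add[of f g] by (simp add: lookup_add distrib_right sum.distrib)
qed

lemma hom_fun_zero: "hom_fun d (\<lambda>x. 0)"
  unfolding hom_fun_def by (rule exI[of _ 0]) (auto simp: homogeneous_alt mpoly_eval_alt)

lemma hom_fun_add: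
  assumes "hom_fun d g" "hom_fun d h"
  shows "hom_fun d (\<lambda>x. g x + h x)"
proof -
  obtain p q where "homogeneous d p" "mpoly_eval p = g" "homogeneous d q" "mpoly_eval q = h"
    using assms by (auto simp: hom_fun_def)
  then show ?thesis
    using Poly_Mapping.keys_add[of p q] unfolding hom_fun_def homogeneous_alt
    by (intro exI[of _ "p + q"]) (auto simp: mpoly_eval_add)
qed

lemma hom_fun_sum:
  assumes "\<And>a. a \<in> A \<Longrightarrow> hom_fun d (g a)"
  shows "hom_fun d (\<lambda>x. \<Sum>a\<in>A. g a x)"
  using assms
  by (induction A rule: infinite_finite_induct) (auto intro: hom_fun_zero hom_fun_add)

lemma hom_fun_monomial:
  assumes "monomial_degree e = d"
  shows "hom_fun d (\<lambda>x. c * monomial_fun e x)"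
  unfolding hom_fun_def
  by (rule exI[of _ "Poly_Mapping.single e c"])
     (use assms in \<open>auto simp: homogeneous_alt mpoly_eval_alt fun_eq_iff\<close>)

lemma hom_fun_mult:
  assumes "hom_fun d g" "hom_fun d' h"
  shows "hom_fun (d + d') (\<lambda>x. g x * h x)"
proof -
  obtain p q where p: "homogeneous d p" "mpoly_eval p = g"
    and q: "homogeneous d' q" "mpoly_eval q = h"
    using assms by (auto simp: hom_fun_def)
  \<comment> \<open>Expanding both sums into monomials avoids computing the support of the product
    polynomial.\<close>
  have "(\<lambda>x. g x * h x) = (\<lambda>x. \<Sum>e\<in>Poly_Mapping.keys p. \<Sum>e'\<in>Poly_Mapping.keys q.
      (Poly_Mapping.lookup p e * Poly_Mapping.lookup q e') * monomial_fun (e + e') x)"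
    unfolding p(2)[symmetric] q(2)[symmetric] mpoly_eval_alt sum_product
    by (simp add: monomial_fun_add mult_ac)
  moreover have "hom_fun (d + d') \<dots>"
    by (intro hom_fun_sum hom_fun_monomial)
       (use p q in \<open>auto simp: homogeneous_alt monomial_degree_add\<close>)
  ultimately show ?thesis by simp
qed

lemma hom_fun_coord: "hom_fun 1 (\<lambda>x. x $ i)"
proof -
  let ?e = "Poly_Mapping.single i (1::nat)"
  have eq: "Poly_Mapping.lookup ?e l = (if l = i then 1 else 0)" for l
    by (simp add: lookup_single when_def)
  have "monomial_degree ?e = 1"
    unfolding monomial_degree_def eq by simp
  moreover have "monomial_fun ?e x = x $ i" for x
    unfolding monomial_fun_def eq by (simp add: if_distrib[of "\<lambda>k. _ ^ k"] prod.delta cong: if_cong)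
  ultimately show ?thesis
    using hom_fun_monomial[of ?e 1 1] by simp
qed

lemma hom_fun_uminus:
  assumes "hom_fun d g"
  shows "hom_fun d (\<lambda>x. - g x)"
proof -
  have "hom_fun 0 (\<lambda>x. (-1) * monomial_fun 0 x)"
    by (rule hom_fun_monomial) (simp add: monomial_degree_def)
  from hom_fun_mult[OF this assms] show ?thesis
    by (simp add: monomial_fun_def)
qed

lemma hom_fun_diff:
  assumes "hom_fun d g" "hom_fun d h"
  shows "hom_fun d (\<lambda>x. g x - h x)"
  using hom_fun_add[OF assms(1) hom_fun_uminus[OF assms(2)]] by simp

lemma zariski_closedI:
  assumes "\<And>g. g \<in> G \<Longrightarrow> \<exists>d. hom_fun d g"
  shows "zariski_closed {P. \<forall>x\<in>coords P. \<forall>g\<in>G. g x = 0}"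
proof -
  obtain f where f: "\<And>g. g \<in> G \<Longrightarrow> (\<exists>d. homogeneous d (f g)) \<and> mpoly_eval (f g) = g"
    using assms unfolding hom_fun_def by metis
  show ?thesis
    unfolding zariski_closed_def by (rule exI[of _ "f ` G"]) (use f in fastforce)
qed

text \<open>Lets a polynomial identity on a punctured line be extended to the missing point, as the
  closure computation for the cone requires.\<close>

lemma continuous_on_mpoly_eval: "continuous_on UNIV (mpoly_eval f)"
  unfolding mpoly_eval_def by (intro continuous_intros)


section \<open>Matrices of bounded rank\<close>

text \<open>Rank is bounded by the number of outer products in a decomposition. This makes sense for
  any index types; the summands are labelled by naturals because an existential cannot range over
  types.\<close>

definition rank_le :: "nat \<Rightarrow> ('a \<Rightarrow> 'b \<Rightarrow> complex) \<Rightarrow> bool"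
  where "rank_le k A \<longleftrightarrow> (\<exists>(L :: nat set) u v. finite L \<and> card L \<le> k \<and>
    (\<forall>i j. A i j = (\<Sum>l\<in>L. u l i * v l j)))"

text \<open>Reindexing frees the label type: decompositions below are labelled by options, by rows
  or by vectors.\<close>

lemma rank_leI:
  fixes u :: "'l \<Rightarrow> 'a \<Rightarrow> complex"
  assumes "finite L" "card L \<le> k" "\<And>i j. A i j = (\<Sum>l\<in>L. u l i * v l j)"
  shows "rank_le k A"
proof -
  obtain h where h: "bij_betw h {0..<card L} L"
    using ex_bij_betw_nat_finite[OF assms(1)] by blast
  have "A i j = (\<Sum>l\<in>{0..<card L}. (u \<circ> h) l i * (v \<circ> h) l j)" for i j
    using sum.reindex_bij_betw[OF h, of "\<lambda>l. u l i * v l j"] assms(3) by simp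
  with assms(2) show ?thesis
    unfolding rank_le_def
    by (intro exI[of _ "{0..<card L}"] exI[of _ "u \<circ> h"] exI[of _ "v \<circ> h"]) auto
qed

lemma rank_leE:
  assumes "rank_le k A"
  obtains L :: "nat set" and u v where "finite L" "card L \<le> k" "\<And>i j. A i j = (\<Sum>l\<in>L. u l i * v l j)"
  using assms unfolding rank_le_def by blast

section \<open>Operations on matrices of bounded rank\<close>

lemma rank_le_mono:
  assumes "rank_le k A" "k \<le> k'"
  shows "rank_le k' A"
proof -
  obtain L :: "nat set" and u v where L: "finite L" "card L \<le> k"
    and A: "\<And>i j. A i j = (\<Sum>l\<in>L. u l i * v l j)"
    using assms by (auto elim: rank_leE)
  show ?thesis
    using L assms(2) by (intro rank_leI[of L _ _ u v] A) simp_all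
qed

lemma rank_le_0: "rank_le 0 A \<longleftrightarrow> (\<forall>i j. A i j = 0)"
proof
  assume "rank_le 0 A"
  then show "\<forall>i j. A i j = 0" by (auto elim: rank_leE)
next
  assume "\<forall>i j. A i j = 0"
  then show "rank_le 0 A" by (intro rank_leI[of "{}"]) auto
qed

lemma rank_le_scale:
  assumes "rank_le k A"
  shows "rank_le k (\<lambda>i j. c * A i j)"
proof -
  obtain L :: "nat set" and u v where L: "finite L" "card L \<le> k"
    and A: "\<And>i j. A i j = (\<Sum>l\<in>L. u l i * v l j)"
    using assms by (auto elim: rank_leE)
  show ?thesis
    by (rule rank_leI[OF L, of _ "\<lambda>l i. c * u l i" v]) (simp add: A sum_distrib_left mult_ac)
qed

lemma rank_le_scale_iff:
  assumes "c \<noteq> 0"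
  shows "rank_le k (\<lambda>i j. c * A i j) \<longleftrightarrow> rank_le k A"
proof
  assume "rank_le k (\<lambda>i j. c * A i j)"
  from rank_le_scale[OF this, of "inverse c"] show "rank_le k A"
    using assms by (simp add: mult.assoc[symmetric])
qed (rule rank_le_scale)

lemma rank_le_add_outer:
  assumes "rank_le k A"
  shows "rank_le (Suc k) (\<lambda>i j. A i j + a i * b j)"
proof -
  obtain L :: "nat set" and u v where L: "finite L" "card L \<le> k"
    and A: "\<And>i j. A i j = (\<Sum>l\<in>L. u l i * v l j)"
    using assms by (auto elim: rank_leE)
  show ?thesis
    by (rule rank_leI[of "insert None (Some ` L)" _ _ "case_option a u" "case_option b v"])
       (use L in \<open>auto simp: A sum.reindex card_insert_if card_image\<close>)
qed

lemma rank_le_outer: "rank_le 1 (\<lambda>i j. a i * b j)"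
  using rank_le_add_outer[of 0 "\<lambda>i j. 0" a b] by (simp add: rank_le_0)

lemma rank_le_comp:
  assumes "rank_le k A"
  shows "rank_le k (\<lambda>i j. A (f i) (g j))"
proof -
  obtain L :: "nat set" and u v where L: "finite L" "card L \<le> k"
    and A: "\<And>i j. A i j = (\<Sum>l\<in>L. u l i * v l j)"
    using assms by (auto elim: rank_leE)
  show ?thesis
    by (rule rank_leI[OF L, of _ "\<lambda>l i. u l (f i)" "\<lambda>l j. v l (g j)"]) (rule A)
qed

text \<open>A matrix is the sum over its rows of a unit column times that row.\<close>

lemma rank_le_card: "rank_le CARD('a) (A :: 'a::finite \<Rightarrow> 'b \<Rightarrow> complex)"
  by (rule rank_leI[of UNIV _ _ "\<lambda>l i. if i = l then 1 else 0" A])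
     (auto simp: if_distrib[of "\<lambda>c. c * _"] cong: if_cong)

text \<open>Multiplying through by the pivot avoids division, so entries stay polynomial. The index
  set is kept; row \<open>p\<close> and column \<open>q\<close> of the result vanish.\<close>

definition schur :: "'a \<Rightarrow> 'b \<Rightarrow> ('a \<Rightarrow> 'b \<Rightarrow> complex) \<Rightarrow> 'a \<Rightarrow> 'b \<Rightarrow> complex"
  where "schur p q A i j = A p q * A i j - A i q * A p j"

text \<open>Gaussian elimination on a decomposition: one outer product is traded for a multiple of
  row \<open>p\<close>, which the Schur complement kills. Conversely, \<open>A p q\<close> times
  \<open>A\<close> is the Schur complement plus the outer product of column \<open>q\<close> and row
  \<open>p\<close>.\<close>

lemma rank_le_schur:
  assumes "A p q \<noteq> 0"
  shows "rank_le (Suc k) A \<longleftrightarrow> rank_le k (schur p q A)"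
proof
  assume "rank_le (Suc k) A"
  then obtain L :: "nat set" and u v where L: "finite L" "card L \<le> Suc k"
    and A: "\<And>i j. A i j = (\<Sum>l\<in>L. u l i * v l j)"
    by (auto elim: rank_leE)
  have "(\<Sum>l\<in>L. u l p * v l q) \<noteq> 0" using assms A by simp
  then obtain m where "m \<in> L" "u m p * v m q \<noteq> 0"
    by (rule sum.not_neutral_contains_not_neutral)
  then have m: "m \<in> L" "u m p \<noteq> 0" by auto
  \<comment> \<open>Coefficients of row \<open>i\<close> after subtracting
    \<open>u m i / u m p\<close> times row \<open>p\<close>. Since \<open>u' m i = 0\<close>, the
    summand \<open>m\<close> drops out.\<close>
  define u' where "u' l i = u l i - u m i * u l p / u m p" for l i
  have A': "A i j = (\<Sum>l\<in>L - {m}. u' l i * v l j) + u m i / u m p * A p j" for i j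
  proof -
    have "(\<Sum>l\<in>L - {m}. u' l i * v l j) = (\<Sum>l\<in>L. u' l i * v l j)"
      using L m by (simp add: sum.remove[of L m] u'_def)
    also have "\<dots> = A i j - u m i / u m p * A p j"
      unfolding u'_def A by (simp add: left_diff_distrib sum_subtractf sum_distrib_left mult.assoc)
    finally show ?thesis by simp
  qed
  show "rank_le k (schur p q A)"
  proof (rule rank_leI)
    show "finite (L - {m})" "card (L - {m}) \<le> k" using L m by auto
    fix i j
    \<comment> \<open>Only the entries in row \<open>i\<close> are expanded; their multiples of row
      \<open>p\<close> cancel.\<close>
    have "schur p q A i j = A p q * (\<Sum>l\<in>L - {m}. u' l i * v l j) - (\<Sum>l\<in>L - {m}. u' l i * v l q) * A p j"
      unfolding schur_def by (subst A'[of i j], subst A'[of i q]) (simp add: algebra_simps)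
    also have "\<dots> = (\<Sum>l\<in>L - {m}. u' l i * (A p q * v l j - v l q * A p j))"
      by (simp add: sum_distrib_left sum_distrib_right right_diff_distrib sum_subtractf mult_ac)
    finally show "schur p q A i j = (\<Sum>l\<in>L - {m}. u' l i * (A p q * v l j - v l q * A p j))" .
  qed
next
  assume "rank_le k (schur p q A)"
  from rank_le_add_outer[OF this, of "\<lambda>i. A i q" "\<lambda>j. A p j"]
  have "rank_le (Suc k) (\<lambda>i j. A p q * A i j)" by (simp add: schur_def)
  then show "rank_le (Suc k) A" using assms by (simp add: rank_le_scale_iff)
qed

text \<open>At a zero pivot the Schur complement is an outer product, so it imposes no condition
  unless \<open>k = 0\<close>, where it holds anyway.\<close>

lemma rank_le_Suc_iff: "rank_le (Suc k) A \<longleftrightarrow> (\<forall>p q. rank_le k (schur p q A))"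
proof
  assume r: "rank_le (Suc k) A"
  show "\<forall>p q. rank_le k (schur p q A)"
  proof (intro allI)
    fix p q
    consider "A p q \<noteq> 0" | "A p q = 0" "k = 0" | "A p q = 0" "k \<ge> 1" by linarith
    then show "rank_le k (schur p q A)"
    proof cases
      case 1
      then show ?thesis using r by (simp only: rank_le_schur)
    next
      case 2
      \<comment> \<open>If this product were nonzero, \<open>A i q\<close> would be a usable pivot,
        and the entry at \<open>(p, j)\<close> of its vanishing Schur complement is exactly this
        product, as \<open>A p q = 0\<close>.\<close>
      have "A i q * A p j = 0" for i j
      proof (rule ccontr)
        assume nz: "A i q * A p j \<noteq> 0"
        then have "rank_le k (schur i q A)"
          using r by (subst rank_le_schur[symmetric]) auto
        then have "A i q * A p j - A p q * A i j = 0"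
          using 2 by (auto simp: rank_le_0 schur_def)
        with nz 2 show False by simp
      qed
      then show ?thesis using 2 by (simp add: rank_le_0 schur_def)
    next
      case 3
      have "rank_le 1 (\<lambda>i j. (- A i q) * A p j)" by (rule rank_le_outer)
      then have "rank_le 1 (schur p q A)" using 3 by (simp add: schur_def[abs_def])
      then show ?thesis using 3(2) by (rule rank_le_mono)
    qed
  qed
next
  assume r: "\<forall>p q. rank_le k (schur p q A)"
  show "rank_le (Suc k) A"
  proof (cases "\<forall>p q. A p q = 0")
    case True
    then show ?thesis using rank_le_mono[of 0 A] by (simp add: rank_le_0)
  next
    case False
    then obtain p q where "A p q \<noteq> 0" by auto
    then show ?thesis using r rank_le_schur[of A p q k] by simp
  qed
qed

text \<open>Stated for matrices of homogeneous functions of a common degree so that the induction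
  can pass to Schur complements, whose entries have degree \<open>d + d\<close>. The equations for
  all pivots are collected.\<close>

lemma rank_le_equations:
  fixes g :: "'a \<Rightarrow> 'b \<Rightarrow> complex ^ 'i::finite \<Rightarrow> complex"
  assumes "\<And>i j. hom_fun d (g i j)"
  shows "\<exists>G. (\<forall>h\<in>G. \<exists>d. hom_fun d h) \<and>
    (\<forall>x. rank_le k (\<lambda>i j. g i j x) \<longleftrightarrow> (\<forall>h\<in>G. h x = 0))"
  using assms
proof (induction k arbitrary: d g)
  case 0
  have "(\<forall>h\<in>\<Union>i j. {g i j}. \<exists>d. hom_fun d h) \<and>
    (\<forall>x. rank_le 0 (\<lambda>i j. g i j x) \<longleftrightarrow> (\<forall>h\<in>\<Union>i j. {g i j}. h x = 0))"
    using 0 unfolding rank_le_0 by blast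
  then show ?case by (rule exI)
next
  case (Suc k)
  define s where "s p q i j x = schur p q (\<lambda>i j. g i j x) i j" for p q i j x
  have "hom_fun (d + d) (s p q i j)" for p q i j
    unfolding s_def schur_def by (intro hom_fun_diff hom_fun_mult Suc.prems)
  then have "\<exists>G. (\<forall>h\<in>G. \<exists>d. hom_fun d h) \<and>
    (\<forall>x. rank_le k (\<lambda>i j. s p q i j x) \<longleftrightarrow> (\<forall>h\<in>G. h x = 0))" for p q
    by (rule Suc.IH)
  then have "\<forall>p q. \<exists>G. (\<forall>h\<in>G. \<exists>d. hom_fun d h) \<and>
    (\<forall>x. rank_le k (\<lambda>i j. s p q i j x) \<longleftrightarrow> (\<forall>h\<in>G. h x = 0))"
    by blast
  then obtain G where "\<forall>p q. (\<forall>h\<in>G p q. \<exists>d. hom_fun d h) \<and>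
    (\<forall>x. rank_le k (\<lambda>i j. s p q i j x) \<longleftrightarrow> (\<forall>h\<in>G p q. h x = 0))"
    unfolding choice_iff by (elim exE)
  then have G: "\<And>p q h. h \<in> G p q \<Longrightarrow> \<exists>d. hom_fun d h"
    "\<And>p q x. rank_le k (\<lambda>i j. s p q i j x) \<longleftrightarrow> (\<forall>h\<in>G p q. h x = 0)"
    by blast+
  have "rank_le (Suc k) (\<lambda>i j. g i j x) \<longleftrightarrow> (\<forall>p q. \<forall>h\<in>G p q. h x = 0)" for x
  proof -
    have "rank_le k (schur p q (\<lambda>i j. g i j x)) \<longleftrightarrow> (\<forall>h\<in>G p q. h x = 0)" for p q
      using G(2)[of p q x] by (simp only: s_def)
    then show ?thesis by (simp only: rank_le_Suc_iff)
  qed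
  then have "(\<forall>h\<in>\<Union>p q. G p q. \<exists>d. hom_fun d h) \<and>
    (\<forall>x. rank_le (Suc k) (\<lambda>i j. g i j x) \<longleftrightarrow> (\<forall>h\<in>\<Union>p q. G p q. h x = 0))"
    using G(1) by auto
  then show ?case by (rule exI)
qed

lemma zariski_closed_rank_le:
  fixes g :: "'a \<Rightarrow> 'b \<Rightarrow> complex ^ 'i::finite \<Rightarrow> complex"
  assumes "\<And>i j. hom_fun d (g i j)"
  shows "zariski_closed {P. \<forall>x\<in>coords P. rank_le k (\<lambda>i j. g i j x)}"
proof -
  obtain G where G: "\<forall>h\<in>G. \<exists>d. hom_fun d h"
    and eq: "\<And>x. rank_le k (\<lambda>i j. g i j x) \<longleftrightarrow> (\<forall>h\<in>G. h x = 0)"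
    using rank_le_equations[where g = g and d = d and k = k, OF assms] by blast
  show ?thesis unfolding eq by (rule zariski_closedI) (use G in blast)
qed


section \<open>Secant varieties of Segre varieties\<close>

lemma coordsD: "x \<in> coords P \<Longrightarrow> x \<noteq> 0" "x \<in> coords P \<Longrightarrow> point x = P"
  by (auto simp: coords_def)

lemma coords_pointI: "x \<noteq> 0 \<Longrightarrow> x \<in> coords (point x)"
  by (simp add: coords_def)

text \<open>Used to test loci, which quantify over all representatives, on a single one.\<close>

lemma ball_coords_point:
  assumes "x \<noteq> 0" "\<And>c. c \<noteq> 0 \<Longrightarrow> Q (c *s x) \<longleftrightarrow> Q x"
  shows "(\<forall>y\<in>coords (point x). Q y) \<longleftrightarrow> Q x"
  using assms coords_pointI[OF assms(1)] by (auto simp: coords_point)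

section \<open>Rank loci and the Segre variety\<close>

definition rank_locus :: "nat \<Rightarrow> ('a::finite \<times> 'b::finite) proj set"
  where "rank_locus k = {P. \<forall>x\<in>coords P. rank_le k (\<lambda>i j. x $ (i, j))}"

lemma point_in_rank_locus:
  assumes "x \<noteq> 0"
  shows "point x \<in> rank_locus k \<longleftrightarrow> rank_le k (\<lambda>i j. x $ (i, j))"
  unfolding rank_locus_def mem_Collect_eq
  by (rule ball_coords_point[OF assms]) (simp add: rank_le_scale_iff)

lemma zariski_closed_rank_locus: "zariski_closed (rank_locus k)"
  unfolding rank_locus_def by (rule zariski_closed_rank_le[OF hom_fun_coord])

text \<open>The affine cone over \<open>segre\<close> without the origin, where spans and bases can
  be formed.\<close>

definition rank_one :: "(complex ^ ('a::finite \<times> 'b::finite)) set"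
  where "rank_one = {x. x \<noteq> 0 \<and> rank_le 1 (\<lambda>i j. x $ (i, j))}"

lemma rank_le_1D:
  assumes "rank_le 1 A"
  shows "\<exists>a b. \<forall>i j. A i j = a i * b j"
proof -
  obtain L :: "nat set" and u v where L: "finite L" "card L \<le> 1"
    and A: "\<And>i j. A i j = (\<Sum>l\<in>L. u l i * v l j)"
    using assms by (auto elim: rank_leE)
  have "card L = 0 \<or> card L = 1" using L(2) by linarith
  then consider "L = {}" | l where "L = {l}"
    using L(1) by (auto simp: card_1_singleton_iff)
  then show ?thesis
  proof cases
    case 1
    then show ?thesis by (intro exI[of _ "\<lambda>_. 0"]) (simp add: A)
  next
    case 2
    then show ?thesis by (intro exI[of _ "u l"] exI[of _ "v l"]) (simp add: A)
  qed
qed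

text \<open>The rank is the dimension of the row span. If it is 1, all rows are multiples of one
  vector, which gives an outer product; rank 0 is excluded by \<open>x \<noteq> 0\<close>.\<close>

lemma rank_coord_matrix_eq_1_iff: "rank (coord_matrix x) = 1 \<longleftrightarrow> x \<in> rank_one"
proof
  assume r: "rank (coord_matrix x) = 1"
  obtain B where B: "rows (coord_matrix x) \<subseteq> vec.span B" "card B = 1"
    using vec.basis_exists[of "rows (coord_matrix x)"] r
    unfolding row_rank_def_gen by metis
  then obtain b where b: "B = {b}" by (auto simp: card_1_singleton_iff)
  have "\<forall>i. \<exists>c. row i (coord_matrix x) = c *s b"
    using B(1) unfolding b by (auto simp: rows_def vec.span_singleton)
  then obtain c where c: "\<And>i. row i (coord_matrix x) = c i *s b" by metis
  have "x $ (i, j) = c i * b $ j" for i j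
    using c[of i] by (simp add: vec_eq_iff row_def coord_matrix_def)
  then have "rank_le 1 (\<lambda>i j. x $ (i, j))"
    using rank_le_outer[of c "\<lambda>j. b $ j"] by simp
  moreover have "x \<noteq> 0"
  proof
    assume "x = 0"
    then have "rows (coord_matrix x) \<subseteq> {0}"
      by (auto simp: rows_def row_def coord_matrix_def vec_eq_iff)
    then have "vec.dim (rows (coord_matrix x)) = 0" by (simp add: vec.dim_eq_0)
    with r show False by (simp add: row_rank_def_gen)
  qed
  ultimately show "x \<in> rank_one" by (simp add: rank_one_def)
next
  assume x: "x \<in> rank_one"
  then have "rank_le 1 (\<lambda>i j. x $ (i, j))" by (simp only: rank_one_def mem_Collect_eq)
  from rank_le_1D[OF this] obtain a b where ab: "\<And>i j. x $ (i, j) = a i * b j"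
    by blast
  have "row i (coord_matrix x) = a i *s (\<chi> j. b j)" for i
    by (simp add: vec_eq_iff row_def coord_matrix_def ab)
  then have "rows (coord_matrix x) \<subseteq> vec.span {\<chi> j. b j}"
    by (auto simp: rows_def vec.span_singleton)
  from vec.dim_le_card[OF this] have "rank (coord_matrix x) \<le> 1"
    by (simp add: row_rank_def_gen)
  moreover have "rank (coord_matrix x) \<noteq> 0"
  proof
    assume "rank (coord_matrix x) = 0"
    then have "rows (coord_matrix x) \<subseteq> {0}"
      by (simp add: row_rank_def_gen vec.dim_eq_0)
    then have "row i (coord_matrix x) = 0" for i by (auto simp: rows_def)
    then have "x = 0" by (auto simp: row_def coord_matrix_def vec_eq_iff)
    with x show False by (simp add: rank_one_def)
  qed
  ultimately show "rank (coord_matrix x) = 1" by linarith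
qed

lemma segre_eq_rank_locus: "segre = rank_locus 1"
  unfolding segre_def rank_locus_def rank_coord_matrix_eq_1_iff rank_one_def
  using coordsD(1) by blast

lemma point_in_segre: "x \<in> rank_one \<Longrightarrow> point x \<in> segre"
  by (simp add: segre_eq_rank_locus rank_one_def point_in_rank_locus)

lemma segre_rep: "P \<in> segre \<Longrightarrow> proj_rep P \<in> rank_one"
  using proj_rep_coords[of P] unfolding segre_def rank_coord_matrix_eq_1_iff by blast

lemma rank_le_span:
  assumes B: "finite B" "card B \<le> k" "B \<subseteq> rank_one" and x: "x \<in> vec.span B"
  shows "rank_le k (\<lambda>i j. x $ (i, j))"
proof -
  obtain w where w: "x = (\<Sum>b\<in>B. w b *s b)"
    using x B(1) by (auto simp: vec.span_finite)
  have "\<forall>b\<in>B. \<exists>u v. \<forall>i j. b $ (i, j) = u i * v j"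
  proof
    fix b assume "b \<in> B"
    then have "rank_le 1 (\<lambda>i j. b $ (i, j))" using B(3) unfolding rank_one_def by blast
    then show "\<exists>u v. \<forall>i j. b $ (i, j) = u i * v j" by (rule rank_le_1D)
  qed
  then obtain u v where uv: "\<And>b i j. b \<in> B \<Longrightarrow> b $ (i, j) = u b i * v b j"
    by metis
  show ?thesis
    by (rule rank_leI[OF B(1,2), of _ "\<lambda>b i. w b * u b i" v]) (simp add: w uv mult.assoc)
qed

lemma rank_le_spanE:
  assumes "rank_le k (\<lambda>i j. x $ (i, j))"
  obtains T where "finite T" "card T \<le> k" "T \<subseteq> rank_one" "x \<in> vec.span T"
proof -
  obtain L :: "nat set" and u v where L: "finite L" "card L \<le> k"
    and x: "\<And>i j. x $ (i, j) = (\<Sum>l\<in>L. u l i * v l j)"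
    using assms by (auto elim: rank_leE)
  define f where "f l = (\<chi> p. u l (fst p) * v l (snd p))" for l
  have "rank_le 1 (\<lambda>i j. f l $ (i, j))" for l
    using rank_le_outer[of "u l" "v l"] by (simp add: f_def)
  \<comment> \<open>Zero summands must go, since \<open>rank_one\<close> omits the origin; the span
    does not change.\<close>
  then have "f ` L - {0} \<subseteq> rank_one" by (auto simp: rank_one_def)
  moreover have "card (f ` L - {0}) \<le> k"
    using L card_image_le[of L f] card_Diff1_le[of "f ` L" 0] by linarith
  moreover have "x \<in> vec.span (f ` L - {0})"
  proof -
    have "x = (\<Sum>l\<in>L. f l)" by (auto simp: vec_eq_iff x f_def)
    moreover have "f l \<in> vec.span (f ` L - {0})" if "l \<in> L" for l
      using that by (cases "f l = 0") (auto intro: vec.span_base vec.span_zero)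
    ultimately show ?thesis by (auto intro: vec.span_sum)
  qed
  moreover have "finite (f ` L - {0})" using L(1) by simp
  ultimately show thesis by (intro that)
qed

text \<open>Gives nondegeneracy, and lets independent rank one matrices be completed to a basis of
  such matrices.\<close>

lemma span_rank_one: "vec.span rank_one = (UNIV :: (complex ^ ('a::finite \<times> 'b::finite)) set)"
proof -
  have "x \<in> vec.span rank_one" for x :: "complex ^ ('a \<times> 'b)"
    using rank_le_card[of "\<lambda>i j. x $ (i, j)"] by (rule rank_le_spanE) (use vec.span_mono in blast)
  then show ?thesis by blast
qed

lemma nondegenerate_segre: "nondegenerate (segre :: ('a::finite \<times> 'b::finite) proj set)"
  unfolding nondegenerate_def
proof (intro allI impI, elim conjE)
  fix V :: "(complex ^ ('a \<times> 'b)) set"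
  assume V: "vec.subspace V" "segre \<subseteq> proj_subspace V"
  have "x \<in> V" if "x \<in> rank_one" for x
    using V(2) point_in_segre[OF that] that coords_pointI[of x]
    by (auto simp: proj_subspace_def rank_one_def)
  then have "vec.span rank_one \<subseteq> V" using V(1) by (intro vec.span_minimal) auto
  then show "V = UNIV" by (simp add: span_rank_one top.extremum_unique)
qed

section \<open>Independent points and the spaces they span\<close>

lemma inj_proj_rep: "inj proj_rep"
  by (rule injI) (metis coordsD(2) proj_rep_coords)

lemma proj_rep_point:
  assumes "x \<noteq> 0"
  shows "\<exists>c. c \<noteq> 0 \<and> proj_rep (point x) = c *s x"
  using proj_rep_coords[of "point x"] assms by (auto simp: coords_point)

lemma proj_independent_points:
  assumes D: "vec.independent D" "0 \<notin> D"
  shows "proj_independent (point ` D)" "card (point ` D) = card D" "finite D"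
proof -
  show fin: "finite D" using D(1) by (rule vec.finiteI_independent)
  define E where "E = (proj_rep \<circ> point) ` D"
  have "D \<subseteq> vec.span E"
  proof
    fix d assume d: "d \<in> D"
    then obtain c where c: "c \<noteq> 0" "proj_rep (point d) = c *s d"
      using D(2) proj_rep_point[of d] by metis
    have "inverse c *s proj_rep (point d) \<in> vec.span E"
      using d by (intro vec.span_scale vec.span_base) (auto simp: E_def)
    then show "d \<in> vec.span E" using c by (simp add: vec.scale_scale)
  qed
  moreover have fE: "finite E" using fin by (simp add: E_def)
  ultimately have "vec.dim D \<le> card E" by (rule vec.dim_le_card)
  then have "card D \<le> card E" using D(1) by (simp add: vec.dim_eq_card_independent)
  moreover have "card E \<le> card (point ` D)"
    using fin unfolding E_def image_comp[symmetric] by (intro card_image_le) auto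
  moreover have "card (point ` D) \<le> card D" using fin by (rule card_image_le)
  ultimately have cards: "card E = card D" "card (point ` D) = card D" by auto
  show "card (point ` D) = card D" by fact
  have "vec.dim D \<le> vec.dim E"
    using vec.dim_subset[OF \<open>D \<subseteq> vec.span E\<close>] by simp
  then have "card E \<le> vec.dim E"
    using cards D(1) by (simp add: vec.dim_eq_card_independent)
  then have "vec.independent E"
    using vec.card_le_dim_spanning[of E E] vec.span_superset fE by blast
  then show "proj_independent (point ` D)"
    by (simp add: proj_independent_def E_def image_comp)
qed

lemma secant_union_segre:
  assumes "Suc k \<le> CARD('a \<times> 'b)"
  shows "\<Union>{\<Lambda>. linear_space k \<Lambda> \<and> (\<exists>S. S \<subseteq> segre \<and> S \<subseteq> \<Lambda> \<and> finite S \<and>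
      card S = k + 1 \<and> proj_independent S)} =
    (rank_locus (Suc k) :: ('a::finite \<times> 'b::finite) proj set)" (is "?U = _")
proof (intro equalityI subsetI)
  fix P :: "('a \<times> 'b) proj"
  assume "P \<in> ?U"
  then obtain V S where V: "vec.subspace V" "vec.dim V = k + 1" "coords P \<subseteq> V"
    and S: "S \<subseteq> segre" "S \<subseteq> proj_subspace V" "finite S" "card S = k + 1" "proj_independent S"
    by (auto simp: linear_space_def proj_subspace_def)
  define B where "B = proj_rep ` S"
  have "card B = card S"
    unfolding B_def by (rule card_image) (rule inj_on_subset[OF inj_proj_rep subset_UNIV])
  with S have B: "finite B" "card B = k + 1" "vec.independent B"
    by (simp_all add: B_def proj_independent_def)
  have B1: "B \<subseteq> rank_one" using S(1) segre_rep by (auto simp: B_def)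
  have BV: "B \<subseteq> V" using S(2) proj_rep_coords unfolding B_def proj_subspace_def by blast
  have "V \<subseteq> vec.span B"
    using V B by (intro vec.card_ge_dim_independent[OF BV]) auto
  with V B B1 show "P \<in> rank_locus (Suc k)"
    unfolding rank_locus_def by (auto intro!: rank_le_span[of B])
next
  fix P :: "('a \<times> 'b) proj"
  assume P: "P \<in> rank_locus (Suc k)"
  define x where "x = proj_rep P"
  have x: "x \<in> coords P" by (simp add: x_def proj_rep_coords)
  with P have "rank_le (Suc k) (\<lambda>i j. x $ (i, j))" by (simp add: rank_locus_def)
  then obtain T where T: "finite T" "card T \<le> Suc k" "T \<subseteq> rank_one" "x \<in> vec.span T"
    by (rule rank_le_spanE)
  obtain B where B: "B \<subseteq> T" "vec.independent B" "T \<subseteq> vec.span B"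
    using vec.maximal_independent_subset by blast
  obtain C where C: "B \<subseteq> C" "C \<subseteq> rank_one" "vec.independent C" "rank_one \<subseteq> vec.span C"
    using vec.maximal_independent_subset_extend[of B rank_one] B T by blast
  have "vec.span rank_one \<subseteq> vec.span C" using C(4) by (simp add: vec.span_minimal)
  then have "vec.span C = vec.span UNIV" by (simp add: span_rank_one top.extremum_unique)
  then have "vec.dim (UNIV :: (complex ^ ('a \<times> 'b)) set) = card C"
    using C(3) by (rule vec.dim_eq_card)
  then have "Suc k \<le> card C" using assms by (simp only: vec_dim_card)
  moreover have "card B \<le> Suc k" using card_mono[OF T(1) B(1)] T(2) by linarith
  ultimately obtain D where D: "B \<subseteq> D" "D \<subseteq> C" "card D = Suc k"
    using exists_subset_between[of B "Suc k" C] C(1) vec.finiteI_independent[OF C(3)] by blast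
  have indD: "vec.independent D" using C(3) D(2) by (rule vec.independent_mono)
  have D0: "0 \<notin> D" using D C by (auto simp: rank_one_def)
  note pts = proj_independent_points[OF indD D0]
  let ?V = "vec.span D"
  have "vec.span T \<subseteq> vec.span B" using B(3) by (simp add: vec.span_minimal)
  then have "x \<in> ?V" using T(4) D(1) vec.span_mono by blast
  then have "P \<in> proj_subspace ?V"
    using coords_point[OF coordsD(1)[OF x]] coordsD(2)[OF x]
    by (auto simp: proj_subspace_def intro: vec.span_scale)
  moreover have "linear_space k (proj_subspace ?V)"
    unfolding linear_space_def
    by (rule exI[of _ ?V]) (simp add: vec.dim_eq_card_independent[OF indD] D)
  moreover have "point ` D \<subseteq> segre" using D C point_in_segre by blast
  moreover have "point ` D \<subseteq> proj_subspace ?V"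
  proof
    fix Q assume "Q \<in> point ` D"
    then obtain d where "Q = point d" "d \<in> D" "d \<noteq> 0" using D0 by auto
    then show "Q \<in> proj_subspace ?V"
      by (auto simp: proj_subspace_def coords_point intro: vec.span_scale vec.span_base)
  qed
  moreover have "finite (point ` D)" "card (point ` D) = k + 1" using pts D(3) by simp_all
  ultimately show "P \<in> ?U" using pts(1) by blast
qed

lemma zariski_closure_closed: "zariski_closed Z \<Longrightarrow> zariski_closure Z = Z"
  unfolding zariski_closure_def by (rule hull_same)

text \<open>The convention for \<open>k\<close> at least the dimension of the ambient space agrees with the general
  formula, since every matrix then has rank at most \<open>k + 1\<close>.\<close>

lemma secant_variety_segre:
  "secant_variety k (segre :: ('a::finite \<times> 'b::finite) proj set) = rank_locus (Suc k)"
proof (cases "CARD('a \<times> 'b) - 1 \<le> k")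
  case True
  have "CARD('a) \<le> CARD('a \<times> 'b)" by simp
  also have "\<dots> \<le> Suc k" using True by linarith
  finally have "rank_le (Suc k) A" for A :: "'a \<Rightarrow> 'b \<Rightarrow> complex"
    using rank_le_card rank_le_mono by blast
  then have "(rank_locus (Suc k) :: ('a \<times> 'b) proj set) = UNIV"
    by (simp add: rank_locus_def)
  with True show ?thesis
    unfolding secant_variety_def by (simp add: nondegenerate_segre)
next
  case False
  then have "Suc k \<le> CARD('a \<times> 'b)" by linarith
  with False show ?thesis
    unfolding secant_variety_def
    by (simp only: secant_union_segre zariski_closure_closed zariski_closed_rank_locus if_False simp_thms)
qed


section \<open>The image under the Cremona transformation\<close>

definition cone_locus :: "nat \<Rightarrow> ('m::finite option \<times> 'n::finite option) proj set"
  where "cone_locus k = {P. \<forall>y\<in>coords P. rank_le k (\<lambda>i j. y $ (Some i, Some j))}"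

lemma point_in_cone_locus:
  assumes "x \<noteq> 0"
  shows "point x \<in> cone_locus k \<longleftrightarrow> rank_le k (\<lambda>i j. x $ (Some i, Some j))"
  unfolding cone_locus_def mem_Collect_eq
  by (rule ball_coords_point[OF assms]) (simp add: rank_le_scale_iff)

lemma point_in_chart:
  assumes "x \<noteq> 0"
  shows "point x \<in> affine_chart \<longleftrightarrow> x $ (None, None) \<noteq> 0"
  unfolding affine_chart_def mem_Collect_eq
  by (rule ball_coords_point[OF assms]) simp

lemma zariski_closed_cone_locus: "zariski_closed (cone_locus k)"
  unfolding cone_locus_def by (rule zariski_closed_rank_le[OF hom_fun_coord])

lemma inner_block_eq_0_iff: "inner_block y = 0 \<longleftrightarrow> (\<forall>i j. y $ (Some i, Some j) = 0)"
  by (auto simp: inner_block_def vec_eq_iff)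

lemma vertex_space_eq_cone_locus: "vertex_space = cone_locus 0"
  by (auto simp: vertex_space_def cone_locus_def inner_block_eq_0_iff rank_le_0)

lemma cone_over_rank_locus: "cone_over (rank_locus k) = cone_locus k"
proof (intro set_eqI)
  fix P :: "('a option \<times> 'b option) proj"
  obtain y where P: "P = point y" and y: "y \<noteq> 0"
    using proj_rep_coords[of P] coordsD by metis
  have scale: "inner_block (c *s y) = c *s inner_block y" for c
    by (simp add: inner_block_def vec_eq_iff)
  have "P \<in> vertex_space \<longleftrightarrow> inner_block y = 0"
    unfolding P vertex_space_def mem_Collect_eq
    by (rule ball_coords_point[OF y]) (simp add: scale)
  moreover have "(\<forall>z\<in>coords P. inner_block z \<noteq> 0 \<and> point (inner_block z) \<in> rank_locus k) \<longleftrightarrow>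
      inner_block y \<noteq> 0 \<and> point (inner_block y) \<in> rank_locus k"
    unfolding P
    by (rule ball_coords_point[OF y])
       (auto simp: scale point_in_rank_locus rank_le_scale_iff)
  moreover have "rank_le k (\<lambda>i j. y $ (Some i, Some j))" if "inner_block y = 0"
    by (rule rank_le_mono[of 0]) (use that in \<open>simp_all add: rank_le_0 inner_block_eq_0_iff\<close>)
  moreover have "point (inner_block y) \<in> rank_locus k \<longleftrightarrow> rank_le k (\<lambda>i j. y $ (Some i, Some j))"
    if "inner_block y \<noteq> 0"
    using that by (simp add: point_in_rank_locus inner_block_def)
  moreover have "P \<in> cone_locus k \<longleftrightarrow> rank_le k (\<lambda>i j. y $ (Some i, Some j))"
    unfolding P by (rule point_in_cone_locus[OF y])
  ultimately show "P \<in> cone_over (rank_locus k) \<longleftrightarrow> P \<in> cone_locus k"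
    unfolding cone_over_def by blast
qed

lemma rank_le_cremona_coords:
  assumes "x $ (None, None) \<noteq> 0"
  shows "rank_le k (\<lambda>i j. cremona_coords x $ (Some i, Some j)) \<longleftrightarrow>
    rank_le (Suc k) (\<lambda>i j. x $ (i, j))"
proof -
  let ?A = "\<lambda>i j. x $ (i, j)"
  let ?B = "\<lambda>i j. cremona_coords x $ (Some i, Some j)"
  have B: "?B i j = schur None None ?A (Some i) (Some j)" for i j
    by (simp add: cremona_coords_def schur_def)
  have "rank_le k ?B \<longleftrightarrow> rank_le k (schur None None ?A)"
  proof
    assume "rank_le k ?B"
    then obtain L :: "nat set" and u v where L: "finite L" "card L \<le> k"
      and uv: "\<And>i j. ?B i j = (\<Sum>l\<in>L. u l i * v l j)"
      by (auto elim: rank_leE)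
    have zero: "schur None None ?A None j = 0" "schur None None ?A i None = 0" for i j
      by (simp_all add: schur_def)
    show "rank_le k (schur None None ?A)"
    proof (rule rank_leI[OF L])
      fix i j
      show "schur None None ?A i j =
          (\<Sum>l\<in>L. case_option 0 (u l) i * case_option 0 (v l) j)"
        using uv unfolding B by (cases i; cases j) (simp_all add: zero)
    qed
  next
    assume "rank_le k (schur None None ?A)"
    then show "rank_le k ?B" unfolding B by (rule rank_le_comp)
  qed
  also have "\<dots> \<longleftrightarrow> rank_le (Suc k) ?A"
    using assms by (simp add: rank_le_schur)
  finally show ?thesis .
qed

lemma cremona_coords_surj:
  assumes "y $ (None, None) \<noteq> 0"
  obtains x where "x $ (None, None) = y $ (None, None)" "cremona_coords x = y $ (None, None) *s y"
proof -
  define x where "x = (\<chi> p. case p of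
      (Some i, Some j) \<Rightarrow> y $ p + y $ (Some i, None) * y $ (None, Some j) / y $ (None, None)
    | _ \<Rightarrow> y $ p)"
  have "x $ (None, None) = y $ (None, None)" by (simp add: x_def)
  moreover have "cremona_coords x $ (i, j) = (y $ (None, None) *s y) $ (i, j)" for i j
    using assms
    by (cases i; cases j) (auto simp: cremona_coords_def x_def power2_eq_square field_simps)
  ultimately show thesis using that[of x] by (simp add: vec_eq_iff)
qed

lemma cremona_rank_locus_chart:
  "cremona ` (rank_locus (Suc k) \<inter> affine_chart) = cone_locus k \<inter> affine_chart"
proof (intro equalityI subsetI)
  fix Q :: "('a option \<times> 'b option) proj"
  assume "Q \<in> cremona ` (rank_locus (Suc k) \<inter> affine_chart)"
  then obtain P where P: "P \<in> rank_locus (Suc k)" "P \<in> affine_chart" "Q = cremona P" by auto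
  obtain x where x: "P = point x" "x \<noteq> 0"
    using proj_rep_coords[of P] coordsD by metis
  have x0: "x $ (None, None) \<noteq> 0" using P(2) x by (simp add: point_in_chart)
  have Q: "Q = point (cremona_coords x)" using P(3) x0 x(1) by (simp add: cremona_point)
  have y0: "cremona_coords x $ (None, None) \<noteq> 0" using x0 by (simp add: cremona_coords_def)
  then have "cremona_coords x \<noteq> 0" by auto
  with P(1) x x0 y0 show "Q \<in> cone_locus k \<inter> affine_chart"
    by (simp add: Q point_in_chart point_in_cone_locus point_in_rank_locus rank_le_cremona_coords)
next
  fix Q :: "('a option \<times> 'b option) proj"
  assume Q: "Q \<in> cone_locus k \<inter> affine_chart"
  obtain y where y: "Q = point y" "y \<noteq> 0"
    using proj_rep_coords[of Q] coordsD by metis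
  have y0: "y $ (None, None) \<noteq> 0" using Q y by (simp add: point_in_chart)
  then obtain x where x: "x $ (None, None) \<noteq> 0" "cremona_coords x = y $ (None, None) *s y"
    by (metis cremona_coords_surj)
  have "x \<noteq> 0" using x(1) by auto
  have "rank_le k (\<lambda>i j. cremona_coords x $ (Some i, Some j))"
    using Q y y0 by (simp add: x(2) point_in_cone_locus rank_le_scale_iff)
  then have "point x \<in> rank_locus (Suc k) \<inter> affine_chart"
    using x(1) \<open>x \<noteq> 0\<close> by (simp add: rank_le_cremona_coords point_in_chart point_in_rank_locus)
  moreover have "cremona (point x) = Q"
    using x y y0 point_eq_iff[of y "y $ (None, None) *s y"] by (auto simp: cremona_point)
  ultimately show "Q \<in> cremona ` (rank_locus (Suc k) \<inter> affine_chart)" by blast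
qed

text \<open>A point \<open>x\<close> of the cone outside the chart is the limit of the points \<open>x + t e\<^sub>0\<^sub>0\<close>
  with \<open>t \<rightarrow> 0\<close>, which lie in the cone and in the chart.\<close>

lemma zariski_closure_cone_locus_chart:
  "zariski_closure (cone_locus k \<inter> affine_chart) = cone_locus k"
  unfolding zariski_closure_def
proof (rule hull_unique)
  show "zariski_closed (cone_locus k)" by (rule zariski_closed_cone_locus)
next
  fix T :: "('a option \<times> 'b option) proj set"
  assume sub: "cone_locus k \<inter> affine_chart \<subseteq> T" and "zariski_closed T"
  then obtain F where T: "T = {P. \<forall>f\<in>F. \<forall>x\<in>coords P. mpoly_eval f x = 0}"
    unfolding zariski_closed_def by blast
  show "cone_locus k \<subseteq> T"
  proof
    fix P :: "('a option \<times> 'b option) proj"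
    assume P: "P \<in> cone_locus k"
    show "P \<in> T"
    proof (cases "P \<in> affine_chart")
      case True
      then show ?thesis using P sub by blast
    next
      case False
      have "mpoly_eval f x = 0" if f: "f \<in> F" and x: "x \<in> coords P" for f x
      proof -
        define z where "z t = x + t *s axis (None, None) 1" for t :: complex
        have x0: "x $ (None, None) = 0" and xk: "rank_le k (\<lambda>i j. x $ (Some i, Some j))"
          using False P point_in_chart[of x] point_in_cone_locus[of x k] coordsD[OF x] by auto
        have zero: "mpoly_eval f (z t) = 0" if "t \<noteq> 0" for t
        proof -
          have z0: "z t $ (None, None) \<noteq> 0" using that x0 by (simp add: z_def)
          then have nz: "z t \<noteq> 0" by auto
          have "rank_le k (\<lambda>i j. z t $ (Some i, Some j))"
            using xk by (simp add: z_def axis_def)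
          then have "point (z t) \<in> T"
            using nz z0 sub by (auto simp: point_in_chart point_in_cone_locus)
          then show ?thesis using f coords_pointI[OF nz] by (auto simp: T)
        qed
        have "continuous_on UNIV z"
          unfolding z_def vector_scalar_mult_def
          by (intro continuous_intros)
        then have "continuous_on UNIV (\<lambda>t. mpoly_eval f (z t))"
          using continuous_on_compose2[OF continuous_on_mpoly_eval] by blast
        then have "(\<lambda>t. mpoly_eval f (z t)) \<midarrow>0\<rightarrow> mpoly_eval f (z 0)"
          by (simp add: continuous_on_def)
        moreover have "(\<lambda>t. mpoly_eval f (z t)) \<midarrow>0\<rightarrow> 0"
          by (rule tendsto_eventually) (simp add: zero eventually_at_filter)
        ultimately have "mpoly_eval f (z 0) = 0" by (rule LIM_unique)
        then show ?thesis by (simp add: z_def)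
      qed
      then show ?thesis by (simp add: T)
    qed
  qed
qed auto

lemma cremona_image_rank_locus: "cremona_image (rank_locus (Suc k)) = cone_locus k"
  by (simp add: cremona_image_def cremona_rank_locus_chart zariski_closure_cone_locus_chart)

theorem mainTheorem2:
  fixes k :: nat
  assumes "k \<ge> 1"
  shows "cremona_image (secant_variety k (segre :: ('m::finite option \<times> 'n::finite option) proj set))
           = cone_over (secant_variety (k - 1) (segre :: ('m \<times> 'n) proj set))
       \<and> cremona_image (segre :: ('m option \<times> 'n option) proj set) = vertex_space"
proof
  have "Suc (k - 1) = k" using assms by simp
  then show "cremona_image (secant_variety k (segre :: ('m option \<times> 'n option) proj set))
      = cone_over (secant_variety (k - 1) (segre :: ('m \<times> 'n) proj set))"
    by (simp only: secant_variety_segre cremona_image_rank_locus cone_over_rank_locus)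
  show "cremona_image (segre :: ('m option \<times> 'n option) proj set) = vertex_space"
    unfolding segre_eq_rank_locus vertex_space_eq_cone_locus One_nat_def
    by (rule cremona_image_rank_locus)
qed

end
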